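(* Let $p,q,n\ge 1$ be integers. Let $K_{p,q}$ be the complete bipartite graph with parts $P$ ($|P|=p$) and $Q$ ($|Q|=q$), and let $K_{p, q}\circ_{1}K_{1,n}$ be the graph obtained by identifying a vertex $a\in P$ with the center of the star $K_{1,n}$; let $N$ denote the set of the $n$ pendant vertices of the star. Then the resistance distances $r_{ij}$ in $K_{p, q}\circ_{1}K_{1,n}$ are: $r(a,x)=\frac{2}{q}$ for $x\in P\setminus\{a\}$; $r(a,y)=\frac{p+q-1}{pq}$ for $y\in Q$; $r(a,z)=1$ for $z\in N$; $r(x,x')=\frac{2}{q}$ for distinct $x,x'\in P\setminus\{a\}$; $r(x,y)=\frac{p+q-1}{pq}$ for $x\in P\setminus\{a\}$, $y\in Q$; $r(x,z)=\frac{q+2}{q}$ for $x\in P\setminus\{a\}$, $z\in N$; $r(y,y')=\frac{2}{p}$ for distinct $y,y'\in Q$; $r(y,z)=\frac{q(p+1)+(p-1)}{pq}$ for $y\in Q$, $z\in N$; $r(z,z')=2$ for distinct $z,z'\in N$.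
   Context: The resistance distance between vertices of a connected graph is the effective resistance between them when every edge is a resistor of $1\Omega$; equivalently $r_{ij}=l^{\#}_{ii}+l^{\#}_{jj}-2l^{\#}_{ij}$ with $L^{\#}$ the group inverse of the Laplacian $L=D-A$. *)

theory Defs
  imports Complex_Main "Graph_Theory.Graph_Theory" "Graph_Theory.Kuratowski"
begin

text \<open>
  A simple graph is a \<^locale>\<open>pair_graph\<close>: a finite, symmetric, loop-free digraph without
  parallel arcs, so that each undirected edge is stored as two opposite arcs.
\<close>

section \<open>The graphs\<close>

definition complete_bipartite :: "'a set \<Rightarrow> 'a set \<Rightarrow> 'a pair_pre_digraph" where
  "complete_bipartite P Q = \<lparr> pverts = P \<union> Q, parcs = P \<times> Q \<union> Q \<times> P \<rparr>"

lemma complete_bipartite_K: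
  assumes "finite P" "finite Q" "P \<inter> Q = {}"
  shows "K\<^bsub>card P, card Q\<^esub> (with_proj (complete_bipartite P Q))"
  using assms unfolding complete_bipartite_digraph_pair_def complete_bipartite_def by auto

definition star :: "'a \<Rightarrow> 'a set \<Rightarrow> 'a pair_pre_digraph" where
  "star c N = complete_bipartite {c} N"

text \<open>
  \<open>coalescence G u H v\<close> is the disjoint union of \<open>G\<close> and \<open>H\<close> with the vertex \<open>v\<close> of \<open>H\<close>
  identified with the vertex \<open>u\<close> of \<open>G\<close>; the merged vertex is represented by \<open>Inl u\<close>.
\<close>

definition identify :: "'a \<Rightarrow> 'b \<Rightarrow> 'a + 'b \<Rightarrow> 'a + 'b" where
  "identify u v w = (if w = Inr v then Inl u else w)"

definition coalescence ::
  "'a pair_pre_digraph \<Rightarrow> 'a \<Rightarrow> 'b pair_pre_digraph \<Rightarrow> 'b \<Rightarrow> ('a + 'b) pair_pre_digraph" where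
  "coalescence G u H v =
     \<lparr> pverts = identify u v ` (Inl ` pverts G \<union> Inr ` pverts H),
       parcs = map_prod (identify u v) (identify u v) `
         (map_prod Inl Inl ` parcs G \<union> map_prod Inr Inr ` parcs H) \<rparr>"

lemma pair_graph_coalescence:
  assumes "pair_graph G" "pair_graph H"
  shows "pair_graph (coalescence G u H v)"
proof -
  interpret G: pair_graph G by fact
  interpret H: pair_graph H by fact
  let ?C = "coalescence G u H v" and ?f = "identify u v"
  have f_Inl: "?f (Inl x) = Inl x" for x
    by (simp add: identify_def)
  have verts_C: "pverts ?C = Inl ` pverts G \<union> (\<lambda>w. ?f (Inr w)) ` pverts H"
    by (simp add: coalescence_def image_Un image_image f_Inl)
  have parcs_C: "parcs ?C = (\<lambda>(x, y). (Inl x, Inl y)) ` parcs G \<union>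
      (\<lambda>(x, y). (?f (Inr x), ?f (Inr y))) ` parcs H"
    by (simp add: coalescence_def image_Un image_image case_prod_unfold map_prod_def f_Inl)
  have arcs: "(s, t) \<in> parcs ?C \<longleftrightarrow>
      (\<exists>x y. (x, y) \<in> parcs G \<and> s = Inl x \<and> t = Inl y) \<or>
      (\<exists>x y. (x, y) \<in> parcs H \<and> s = ?f (Inr x) \<and> t = ?f (Inr y))" for s t
    unfolding parcs_C by auto
  have sym: "(t, s) \<in> parcs ?C" if "(s, t) \<in> parcs ?C" for s t
    using that unfolding arcs by (blast dest: G.arcs_symmetric H.arcs_symmetric)
  have fst_in: "s \<in> pverts ?C" if "(s, t) \<in> parcs ?C" for s t
    using that unfolding arcs verts_C by (blast dest: G.in_arcsD1 H.in_arcsD1)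
  have irrefl: "s \<noteq> t" if "(s, t) \<in> parcs ?C" for s t
    using that unfolding arcs
    by (auto simp: identify_def dest: G.no_loops' H.no_loops' split: if_splits)
  have "finite (pverts ?C)" "finite (parcs ?C)"
    by (simp_all add: coalescence_def G.pair_finite_verts H.pair_finite_verts
        G.pair_finite_arcs H.pair_finite_arcs)
  then show ?thesis
    using sym fst_in fst_in[OF sym] irrefl
    by unfold_locales (auto simp: symmetric_def intro!: symI)
qed

section \<open>Matrices indexed by a vertex set\<close>

text \<open>
  A real matrix with rows and columns indexed by \<open>V\<close> is a function \<open>'a \<Rightarrow> 'a \<Rightarrow> real\<close>
  of which only the values on \<open>V \<times> V\<close> matter.
\<close>

definition mat_mul ::
  "'a set \<Rightarrow> ('a \<Rightarrow> 'a \<Rightarrow> real) \<Rightarrow> ('a \<Rightarrow> 'a \<Rightarrow> real) \<Rightarrow> 'a \<Rightarrow> 'a \<Rightarrow> real" where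
  "mat_mul V A B i j = (\<Sum>k\<in>V. A i k * B k j)"

definition mat_eq :: "'a set \<Rightarrow> ('a \<Rightarrow> 'a \<Rightarrow> real) \<Rightarrow> ('a \<Rightarrow> 'a \<Rightarrow> real) \<Rightarrow> bool" where
  "mat_eq V A B \<longleftrightarrow> (\<forall>i\<in>V. \<forall>j\<in>V. A i j = B i j)"

definition is_group_inverse ::
  "'a set \<Rightarrow> ('a \<Rightarrow> 'a \<Rightarrow> real) \<Rightarrow> ('a \<Rightarrow> 'a \<Rightarrow> real) \<Rightarrow> bool" where
  "is_group_inverse V A X \<longleftrightarrow>
     mat_eq V (mat_mul V (mat_mul V A X) A) A \<and>
     mat_eq V (mat_mul V (mat_mul V X A) X) X \<and>
     mat_eq V (mat_mul V A X) (mat_mul V X A)"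

text \<open>The entries outside \<open>V \<times> V\<close> are set to \<open>0\<close> so that the description is unique.\<close>

definition group_inverse :: "'a set \<Rightarrow> ('a \<Rightarrow> 'a \<Rightarrow> real) \<Rightarrow> 'a \<Rightarrow> 'a \<Rightarrow> real" where
  "group_inverse V A =
     (THE X. is_group_inverse V A X \<and> (\<forall>i j. i \<notin> V \<or> j \<notin> V \<longrightarrow> X i j = 0))"

lemma mat_mul_assoc:
  "mat_mul V (mat_mul V A B) C = mat_mul V A (mat_mul V B C)"
proof (intro ext)
  fix i j
  show "mat_mul V (mat_mul V A B) C i j = mat_mul V A (mat_mul V B C) i j"
    unfolding mat_mul_def sum_distrib_left sum_distrib_right
    by (subst sum.swap) (simp add: mult.assoc)
qed

lemma mat_eq_mul:
  "mat_eq V A A' \<Longrightarrow> mat_eq V B B' \<Longrightarrow> mat_eq V (mat_mul V A B) (mat_mul V A' B')"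
  by (auto simp: mat_eq_def mat_mul_def intro!: sum.cong)

lemma mat_eq_refl: "mat_eq V A A"
  and mat_eq_sym: "mat_eq V A B \<Longrightarrow> mat_eq V B A"
  and mat_eq_trans [trans]: "mat_eq V A B \<Longrightarrow> mat_eq V B C \<Longrightarrow> mat_eq V A C"
  by (auto simp: mat_eq_def)

lemma is_group_inverse_unique:
  assumes X: "is_group_inverse V A X" and Y: "is_group_inverse V A Y"
  shows "mat_eq V X Y"
proof -
  let ?m = "mat_mul V"
  have AXA: "mat_eq V (?m A (?m X A)) A" and XAX: "mat_eq V (?m X (?m A X)) X"
    and cX: "mat_eq V (?m A X) (?m X A)"
    using X by (simp_all add: is_group_inverse_def mat_mul_assoc)
  have AYA: "mat_eq V (?m A (?m Y A)) A" and YAY: "mat_eq V (?m Y (?m A Y)) Y"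
    and cY: "mat_eq V (?m A Y) (?m Y A)"
    using Y by (simp_all add: is_group_inverse_def mat_mul_assoc)
  have "mat_eq V (?m A X) (?m (?m A (?m Y A)) X)"
    by (intro mat_eq_mul mat_eq_refl mat_eq_sym[OF AYA])
  also have "mat_eq V \<dots> (?m (?m A Y) (?m A X))"
    by (simp add: mat_mul_assoc mat_eq_refl)
  also have "mat_eq V \<dots> (?m (?m Y A) (?m X A))"
    by (intro mat_eq_mul cY cX)
  also have "mat_eq V \<dots> (?m Y (?m A (?m X A)))"
    by (simp add: mat_mul_assoc mat_eq_refl)
  also have "mat_eq V \<dots> (?m Y A)"
    by (intro mat_eq_mul AXA mat_eq_refl)
  finally have AX_YA: "mat_eq V (?m A X) (?m Y A)" .
  have "mat_eq V X (?m X (?m A X))" by (rule mat_eq_sym[OF XAX])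
  also have "mat_eq V \<dots> (?m X (?m A Y))"
    by (intro mat_eq_mul mat_eq_refl mat_eq_trans[OF AX_YA mat_eq_sym[OF cY]])
  also have "mat_eq V \<dots> (?m (?m X A) Y)"
    by (simp add: mat_mul_assoc mat_eq_refl)
  also have "mat_eq V \<dots> (?m (?m Y A) Y)"
    by (intro mat_eq_mul mat_eq_refl mat_eq_trans[OF mat_eq_sym[OF cX] AX_YA])
  also have "mat_eq V \<dots> Y"
    using YAY by (simp add: mat_mul_assoc)
  finally show ?thesis .
qed

section \<open>Resistance distance\<close>

definition adjacency_matrix :: "'a pair_pre_digraph \<Rightarrow> 'a \<Rightarrow> 'a \<Rightarrow> real" where
  "adjacency_matrix G i j = (if (i, j) \<in> parcs G then 1 else 0)"

definition degree_matrix :: "'a pair_pre_digraph \<Rightarrow> 'a \<Rightarrow> 'a \<Rightarrow> real" where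
  "degree_matrix G i j = (if i = j then real (out_degree (with_proj G) i) else 0)"

definition laplacian :: "'a pair_pre_digraph \<Rightarrow> 'a \<Rightarrow> 'a \<Rightarrow> real" where
  "laplacian G i j = degree_matrix G i j - adjacency_matrix G i j"

definition resistance :: "'a pair_pre_digraph \<Rightarrow> 'a \<Rightarrow> 'a \<Rightarrow> real" where
  "resistance G i j =
     (let X = group_inverse (pverts G) (laplacian G) in X i i + X j j - 2 * X i j)"

end

theory Submission
  imports Defs
begin

text \<open>
  A symmetric matrix \<open>R\<close> with zero diagonal is the resistance matrix of \<open>G\<close> as soon as
  \<open>L R = w 1\<^sup>T - 2 I\<close> for some vector \<open>w\<close>: double centring of \<open>-R / 2\<close> then yields the group
  inverse \<open>L\<^sup>#\<close>, and double centring does not change \<open>m\<^sub>i\<^sub>i + m\<^sub>j\<^sub>j - 2 m\<^sub>i\<^sub>j\<close>. This criterion is easily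
  verified for complete bipartite graphs, and it is inherited by a coalescence when resistances
  are added across the merged vertex.
\<close>

section \<open>The resistance criterion\<close>

definition neighbours :: "'a pair_pre_digraph \<Rightarrow> 'a \<Rightarrow> 'a set" where
  "neighbours G i = {k. (i, k) \<in> parcs G}"

text \<open>The last clause is \<open>L R = w 1\<^sup>T - 2 I\<close> entrywise, with the sign
  reversed. Writing it as a sum of differences over neighbours keeps it local, so it splits at a
  merged vertex. Setting \<open>i = j\<close> shows that \<open>w i\<close> is \<open>2\<close>
  minus the sum of \<open>R k i\<close> over the neighbours \<open>k\<close> of
  \<open>i\<close>.\<close>

definition resistance_solution ::
  "'a pair_pre_digraph \<Rightarrow> ('a \<Rightarrow> 'a \<Rightarrow> real) \<Rightarrow> ('a \<Rightarrow> real) \<Rightarrow> bool" where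
  "resistance_solution G R w \<longleftrightarrow>
     (\<forall>i\<in>pverts G. R i i = 0) \<and>
     (\<forall>i\<in>pverts G. \<forall>j\<in>pverts G. R i j = R j i) \<and>
     (\<forall>i\<in>pverts G. \<forall>j\<in>pverts G.
        (\<Sum>k\<in>neighbours G i. R k j - R i j) = (if i = j then 2 else 0) - w i)"

section \<open>Group inverses by double centring\<close>

text \<open>Uniqueness of group inverses holds only up to \<open>mat_eq\<close>; vanishing outside
  \<open>V\<close> turns this into equality of functions, as the definite description
  requires.\<close>

lemma group_inverse_eq:
  assumes "is_group_inverse V A X" and "\<And>i j. i \<notin> V \<or> j \<notin> V \<Longrightarrow> X i j = 0"
  shows "group_inverse V A = X"
  unfolding group_inverse_def
proof (rule the_equality)
  show "is_group_inverse V A X \<and> (\<forall>i j. i \<notin> V \<or> j \<notin> V \<longrightarrow> X i j = 0)"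
    using assms by blast
next
  fix Y assume Y: "is_group_inverse V A Y \<and> (\<forall>i j. i \<notin> V \<or> j \<notin> V \<longrightarrow> Y i j = 0)"
  then have "mat_eq V Y X"
    using is_group_inverse_unique assms(1) by blast
  then show "Y = X"
    using Y assms(2) unfolding mat_eq_def by (intro ext) metis
qed

lemma is_group_inverse_cong:
  assumes "is_group_inverse V A X" and "mat_eq V X Y"
  shows "is_group_inverse V A Y"
proof -
  let ?m = "mat_mul V"
  have AXA: "mat_eq V (?m (?m A X) A) A" and XAX: "mat_eq V (?m (?m X A) X) X"
    and c: "mat_eq V (?m A X) (?m X A)"
    using assms(1) by (simp_all add: is_group_inverse_def)
  have YX: "mat_eq V Y X"
    using assms(2) by (rule mat_eq_sym)
  have "mat_eq V (?m (?m A Y) A) A"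
    by (intro mat_eq_trans[OF _ AXA] mat_eq_mul mat_eq_refl YX)
  moreover have "mat_eq V (?m (?m Y A) Y) Y"
    by (rule mat_eq_trans[OF _ mat_eq_trans[OF XAX assms(2)]]) (intro mat_eq_mul mat_eq_refl YX)
  moreover have "mat_eq V (?m A Y) (?m Y A)"
    by (rule mat_eq_trans[OF _ mat_eq_trans[OF c]]) (intro mat_eq_mul mat_eq_refl YX assms(2))+
  ultimately show ?thesis
    by (simp add: is_group_inverse_def)
qed

text \<open>Since \<open>L\<close> annihilates constants, the terms of \<open>X k j\<close> that do
  not depend on \<open>k\<close> do not affect \<open>L X\<close>. Subtracting \<open>m k\<close>
  replaces the defect \<open>w i\<close> by \<open>1 / card V\<close>, so \<open>L X\<close> is the
  projection \<open>I - J / card V\<close>, where \<open>J\<close> is the all-ones matrix. By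
  symmetry so is \<open>X L\<close>, and this projection fixes both \<open>L\<close> and
  \<open>X\<close> because their columns sum to zero.\<close>

lemma double_centring_group_inverse:
  fixes L M :: "'a \<Rightarrow> 'a \<Rightarrow> real" and w :: "'a \<Rightarrow> real"
  assumes fin: "finite V" and ne: "V \<noteq> {}"
    and symL: "\<And>i j. i \<in> V \<Longrightarrow> j \<in> V \<Longrightarrow> L i j = L j i"
    and rowL: "\<And>i. i \<in> V \<Longrightarrow> (\<Sum>k\<in>V. L i k) = 0"
    and symM: "\<And>i j. i \<in> V \<Longrightarrow> j \<in> V \<Longrightarrow> M i j = M j i"
    and LM: "\<And>i j. i \<in> V \<Longrightarrow> j \<in> V \<Longrightarrow>
      (\<Sum>k\<in>V. L i k * M k j) = (if i = j then 1 else 0) - w i"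
  defines "m \<equiv> \<lambda>i. (\<Sum>k\<in>V. M i k) / card V"
  defines "t \<equiv> (\<Sum>k\<in>V. m k) / card V"
  shows "is_group_inverse V L (\<lambda>i j. M i j - m i - m j + t)"
proof -
  define X where "X = (\<lambda>i j. M i j - m i - m j + t)"
  define E :: "'a \<Rightarrow> 'a \<Rightarrow> real"
    where "E = (\<lambda>i j. (if i = j then 1 else 0) - 1 / card V)"
  have card: "real (card V) \<noteq> 0"
    using fin ne by simp
  have symX: "X i j = X j i" if "i \<in> V" "j \<in> V" for i j
    using symM[OF that] by (simp add: X_def)
  \<comment> \<open>This is the hypothesis \<open>LM\<close> averaged over \<open>j\<close>.\<close>
  have Lm: "(\<Sum>k\<in>V. L i k * m k) = 1 / card V - w i" if i: "i \<in> V" for i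
  proof -
    have "(\<Sum>k\<in>V. L i k * m k) = (\<Sum>k\<in>V. \<Sum>j\<in>V. L i k * M k j) / card V"
      by (simp add: m_def sum_distrib_left sum_divide_distrib)
    also have "(\<Sum>k\<in>V. \<Sum>j\<in>V. L i k * M k j) = (\<Sum>j\<in>V. \<Sum>k\<in>V. L i k * M k j)"
      by (rule sum.swap)
    also have "\<dots> = (\<Sum>j\<in>V. (if i = j then 1 else 0) - w i)"
      using LM i by (intro sum.cong) auto
    also have "\<dots> = 1 - card V * w i"
      using i fin by (simp add: sum_subtractf)
    finally show ?thesis
      using card by (simp add: field_simps)
  qed
  have LX: "mat_eq V (mat_mul V L X) E"
    unfolding mat_eq_def
  proof (intro ballI)
    fix i j assume ij: "i \<in> V" "j \<in> V"
    have "mat_mul V L X i j =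
        (\<Sum>k\<in>V. L i k * M k j - L i k * m k - L i k * (m j - t))"
      by (simp add: mat_mul_def X_def algebra_simps)
    also have "\<dots> = (\<Sum>k\<in>V. L i k * M k j) - (\<Sum>k\<in>V. L i k * m k) - (\<Sum>k\<in>V. L i k) * (m j - t)"
      by (simp add: sum_subtractf sum_distrib_right)
    also have "\<dots> = E i j"
      using LM[OF ij] Lm[OF ij(1)] rowL[OF ij(1)] by (simp add: E_def)
    finally show "mat_mul V L X i j = E i j" .
  qed
  have XL: "mat_eq V (mat_mul V X L) E"
    unfolding mat_eq_def
  proof (intro ballI)
    fix i j assume ij: "i \<in> V" "j \<in> V"
    \<comment> \<open>Both factors are symmetric, so \<open>X L\<close> is the transpose of
      \<open>L X\<close>, and \<open>E\<close> is symmetric.\<close>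
    have "mat_mul V X L i j = mat_mul V L X j i"
      unfolding mat_mul_def using ij symX symL by (intro sum.cong) (auto simp: mult.commute)
    then show "mat_mul V X L i j = E i j"
      using LX ij by (auto simp: mat_eq_def E_def)
  qed
  have E_mul: "mat_eq V (mat_mul V E B) B"
    if "\<And>j. j \<in> V \<Longrightarrow> (\<Sum>k\<in>V. B k j) = 0" for B
    unfolding mat_eq_def
  proof (intro ballI)
    fix i j assume ij: "i \<in> V" "j \<in> V"
    have "mat_mul V E B i j = (\<Sum>k\<in>V. (if i = k then B k j else 0)) - (\<Sum>k\<in>V. B k j) / card V"
      unfolding mat_mul_def E_def sum_divide_distrib sum_subtractf[symmetric]
      by (intro sum.cong) (auto simp: algebra_simps)
    then show "mat_mul V E B i j = B i j"
      using that ij fin by simp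
  qed
  have colL: "(\<Sum>k\<in>V. L k j) = 0" if "j \<in> V" for j
  proof -
    have "(\<Sum>k\<in>V. L k j) = (\<Sum>k\<in>V. L j k)"
      using symL that by (intro sum.cong) auto
    then show ?thesis
      using rowL that by simp
  qed
  have colX: "(\<Sum>k\<in>V. X k j) = 0" if "j \<in> V" for j
  proof -
    have "(\<Sum>k\<in>V. X k j) = (\<Sum>k\<in>V. M j k) - (\<Sum>k\<in>V. m k) - card V * m j + card V * t"
      using symM that by (simp add: X_def sum.distrib sum_subtractf)
    then show ?thesis
      using card by (simp add: m_def t_def)
  qed
  have "mat_eq V (mat_mul V (mat_mul V L X) L) L"
    by (rule mat_eq_trans[OF mat_eq_mul[OF LX mat_eq_refl] E_mul[OF colL]])
  moreover have "mat_eq V (mat_mul V (mat_mul V X L) X) X"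
    by (rule mat_eq_trans[OF mat_eq_mul[OF XL mat_eq_refl] E_mul[OF colX]])
  moreover have "mat_eq V (mat_mul V L X) (mat_mul V X L)"
    by (rule mat_eq_trans[OF LX mat_eq_sym[OF XL]])
  ultimately show ?thesis
    by (simp add: is_group_inverse_def X_def)
qed

section \<open>From the Laplacian to resistances\<close>

lemma neighbours_subset: "pair_graph G \<Longrightarrow> neighbours G i \<subseteq> pverts G"
proof -
  assume "pair_graph G"
  then interpret pair_graph G .
  show ?thesis
    by (auto simp: neighbours_def dest: in_arcsD2)
qed

lemma finite_neighbours: "pair_graph G \<Longrightarrow> finite (neighbours G i)"
proof -
  assume G: "pair_graph G"
  then interpret pair_graph G .
  show ?thesis
    using neighbours_subset[OF G] pair_finite_verts by (rule finite_subset)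
qed

lemma out_degree_eq_card_neighbours:
  "out_degree (with_proj G) i = card (neighbours G i)"
proof -
  have "out_arcs (with_proj G) i = Pair i ` neighbours G i"
    by (auto simp: out_arcs_def neighbours_def)
  then show ?thesis
    by (simp add: out_degree_def card_image inj_on_def)
qed

text \<open>The diagonal entry is the number of neighbours, so it contributes one copy of
  \<open>f i\<close> to each neighbour's term.\<close>

lemma laplacian_sum:
  assumes G: "pair_graph G" and i: "i \<in> pverts G"
  shows "(\<Sum>k\<in>pverts G. laplacian G i k * f k) = (\<Sum>k\<in>neighbours G i. f i - f k)"
proof -
  interpret pair_graph G by fact
  have fin: "finite (pverts G)"
    by (rule pair_finite_verts)
  have "(\<Sum>k\<in>pverts G. laplacian G i k * f k) =
      (\<Sum>k\<in>pverts G. (if i = k then card (neighbours G i) * f i else 0)) -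
      (\<Sum>k\<in>pverts G. (if k \<in> neighbours G i then f k else 0))"
    unfolding sum_subtractf[symmetric]
    by (intro sum.cong)
      (auto simp: laplacian_def degree_matrix_def adjacency_matrix_def neighbours_def
        out_degree_eq_card_neighbours left_diff_distrib)
  also have "(\<Sum>k\<in>pverts G. (if k \<in> neighbours G i then f k else 0)) = (\<Sum>k\<in>neighbours G i. f k)"
    using neighbours_subset[OF G, of i] fin by (simp add: sum.inter_restrict[symmetric] Int_absorb1)
  finally show ?thesis
    using i fin by (simp add: sum_subtractf)
qed

lemma resistance_eqI:
  assumes G: "pair_graph G" and R: "resistance_solution G R w"
    and x: "x \<in> pverts G" and y: "y \<in> pverts G"
  shows "resistance G x y = R x y"
proof -
  interpret pair_graph G by fact
  let ?V = "pverts G"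
  \<comment> \<open>The factor \<open>-1/2\<close> turns the \<open>2\<close> on the diagonal of the
    criterion into \<open>1\<close>, and with \<open>R i i = 0\<close> it gives
    \<open>M i i + M j j - 2 * M i j = R i j\<close>.\<close>
  define M where "M = (\<lambda>i j. - R i j / 2)"
  define m where "m = (\<lambda>i. (\<Sum>k\<in>?V. M i k) / card ?V)"
  define t where "t = (\<Sum>k\<in>?V. m k) / card ?V"
  \<comment> \<open>The centred matrix is cut off to \<open>0\<close> outside the vertex set, as
    \<open>group_inverse\<close> demands.\<close>
  define X where "X = (\<lambda>i j. if i \<in> ?V \<and> j \<in> ?V then M i j - m i - m j + t else 0)"
  have R0: "R i i = 0" if "i \<in> ?V" for i
    using R that by (simp add: resistance_solution_def)
  have Rsym: "R i j = R j i" if "i \<in> ?V" "j \<in> ?V" for i j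
    using R that by (simp add: resistance_solution_def)
  have Rsum: "(\<Sum>k\<in>neighbours G i. R k j - R i j) = (if i = j then 2 else 0) - w i"
    if "i \<in> ?V" "j \<in> ?V" for i j
    using R that by (simp add: resistance_solution_def)
  have "is_group_inverse ?V (laplacian G) (\<lambda>i j. M i j - m i - m j + t)"
    unfolding t_def m_def
  proof (rule double_centring_group_inverse)
    show "finite ?V" by (rule pair_finite_verts)
    show "?V \<noteq> {}" using x by blast
    show "laplacian G i j = laplacian G j i" for i j
      using arcs_symmetric[of i j] arcs_symmetric[of j i]
      by (auto simp: laplacian_def degree_matrix_def adjacency_matrix_def)
    show "(\<Sum>k\<in>?V. laplacian G i k) = 0" if "i \<in> ?V" for i
      using laplacian_sum[OF G that, of "\<lambda>_. 1"] by simp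
    show "M i j = M j i" if "i \<in> ?V" "j \<in> ?V" for i j
      using Rsym[OF that] by (simp add: M_def)
    show "(\<Sum>k\<in>?V. laplacian G i k * M k j) = (if i = j then 1 else 0) - w i / 2"
      if ij: "i \<in> ?V" "j \<in> ?V" for i j
    proof -
      have "(\<Sum>k\<in>?V. laplacian G i k * M k j) = (\<Sum>k\<in>neighbours G i. R k j - R i j) / 2"
        unfolding laplacian_sum[OF G ij(1)] sum_divide_distrib M_def
        by (intro sum.cong) (auto simp: field_simps)
      also have "\<dots> = (if i = j then 1 else 0) - w i / 2"
        unfolding Rsum[OF ij] by (simp add: diff_divide_distrib)
      finally show ?thesis .
    qed
  qed
  then have "is_group_inverse ?V (laplacian G) X"
    by (rule is_group_inverse_cong) (simp add: mat_eq_def X_def)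
  then have "group_inverse ?V (laplacian G) = X"
    by (rule group_inverse_eq) (auto simp: X_def)
  then show ?thesis
    using x y by (simp add: resistance_def X_def M_def R0)
qed

section \<open>Complete bipartite graphs\<close>

text \<open>For vertices of the graph the last branch concerns the two ends of an edge. Its value
  agrees with Foster's theorem: by symmetry the \<open>card P * card Q\<close> edges share equally
  the total resistance, which is the number of vertices minus one.\<close>

definition bipartite_resistance :: "'a set \<Rightarrow> 'a set \<Rightarrow> 'a \<Rightarrow> 'a \<Rightarrow> real" where
  "bipartite_resistance P Q i j =
     (if i = j then 0
      else if i \<in> P \<and> j \<in> P then 2 / card Q
      else if i \<in> Q \<and> j \<in> Q then 2 / card P
      else (real (card P) + real (card Q) - 1) / (real (card P) * real (card Q)))"

lemma pair_graph_complete_bipartite: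
  assumes "finite P" "finite Q" "P \<inter> Q = {}"
  shows "pair_graph (complete_bipartite P Q)"
  using assms by unfold_locales (auto simp: complete_bipartite_def symmetric_def intro!: symI)

lemma neighbours_complete_bipartite:
  assumes "P \<inter> Q = {}"
  shows "i \<in> P \<Longrightarrow> neighbours (complete_bipartite P Q) i = Q"
    and "i \<in> Q \<Longrightarrow> neighbours (complete_bipartite P Q) i = P"
  using assms by (auto simp: neighbours_def complete_bipartite_def)

text \<open>With \<open>p\<close>, \<open>q\<close> the part sizes, the sum over the
  \<open>q\<close> neighbours of \<open>i\<close> is
  \<open>(q - 1) * (2 / p) - (p + q - 1) / p\<close> for \<open>j \<in> Q\<close>, and
  \<open>(p + q - 1) / p - 2\<close> for \<open>j \<in> P\<close> other than \<open>i\<close>. These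
  two values coincide, and the common value is the negative of \<open>w i\<close>; for
  \<open>j = i\<close> the \<open>- 2\<close> is absent.\<close>

lemma sum_bipartite_resistance:
  assumes "finite P" "finite Q" "Q \<noteq> {}" "P \<inter> Q = {}" "i \<in> P" "j \<in> P \<union> Q"
  defines "R \<equiv> bipartite_resistance P Q"
  shows "(\<Sum>k\<in>Q. R k j - R i j) =
    (if i = j then 2 else 0) - (real (card P) - real (card Q) + 1) / card P"
proof -
  define p q where "p = real (card P)" and "q = real (card Q)"
  have pq: "p > 0" "q > 0"
    using assms by (auto simp: p_def q_def card_gt_0_iff)
  show ?thesis
  proof (cases "j \<in> Q")
    case True
    \<comment> \<open>The target \<open>j\<close> is itself a neighbour of \<open>i\<close> and
      contributes \<open>0\<close>, which leaves \<open>q - 1\<close> equal terms.\<close>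
    then have "(\<Sum>k\<in>Q. R k j) = R j j + (\<Sum>k\<in>Q - {j}. R k j)"
      using \<open>finite Q\<close> by (intro sum.remove)
    also have "R j j = 0"
      by (simp add: R_def bipartite_resistance_def)
    also have "(\<Sum>k\<in>Q - {j}. R k j) = (\<Sum>k\<in>Q - {j}. 2 / p)"
      using True assms by (intro sum.cong) (auto simp: R_def bipartite_resistance_def p_def)
    also have "0 + \<dots> = (q - 1) * (2 / p)"
      using True \<open>finite Q\<close> pq by (simp add: q_def card_Diff_singleton of_nat_diff Suc_leI)
    finally have "(\<Sum>k\<in>Q. R k j) = (q - 1) * (2 / p)" .
    moreover have "R i j = (p + q - 1) / (p * q)" "i \<noteq> j"
      using True assms by (auto simp: R_def bipartite_resistance_def p_def q_def)
    ultimately show ?thesis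
      using pq by (simp add: sum_subtractf flip: p_def q_def) (simp add: field_simps)
  next
    case False
    then have "(\<Sum>k\<in>Q. R k j) = (\<Sum>k\<in>Q. (p + q - 1) / (p * q))"
      using assms by (intro sum.cong) (auto simp: R_def bipartite_resistance_def p_def q_def)
    moreover have "R i j = (if i = j then 0 else 2 / q)"
      using False assms by (auto simp: R_def bipartite_resistance_def q_def)
    ultimately show ?thesis
      using pq by (simp add: sum_subtractf flip: p_def q_def) (simp add: field_simps)
  qed
qed

lemma bipartite_resistance_swap:
  "P \<inter> Q = {} \<Longrightarrow> bipartite_resistance Q P = bipartite_resistance P Q"
  by (intro ext) (auto simp: bipartite_resistance_def add.commute mult.commute)

text \<open>The equation at a vertex of \<open>Q\<close> is the one at a vertex of \<open>P\<close>
  with the parts exchanged, and \<open>bipartite_resistance\<close> is invariant under this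
  exchange.\<close>

lemma resistance_solution_complete_bipartite:
  assumes "finite P" "finite Q" "P \<noteq> {}" "Q \<noteq> {}" "P \<inter> Q = {}"
  shows "resistance_solution (complete_bipartite P Q) (bipartite_resistance P Q)
    (\<lambda>i. if i \<in> P then (real (card P) - real (card Q) + 1) / card P
         else (real (card Q) - real (card P) + 1) / card Q)"
proof -
  let ?R = "bipartite_resistance P Q"
  have "(\<Sum>k\<in>neighbours (complete_bipartite P Q) i. ?R k j - ?R i j) =
    (if i = j then 2 else 0) -
    (if i \<in> P then (real (card P) - real (card Q) + 1) / card P
     else (real (card Q) - real (card P) + 1) / card Q)"
    if i: "i \<in> P \<union> Q" and j: "j \<in> P \<union> Q" for i j
  proof (cases "i \<in> P")
    case True
    then show ?thesis
      using sum_bipartite_resistance[of P Q i j] assms j neighbours_complete_bipartite(1)[of P Q i]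
      by simp
  next
    case False
    then have "i \<in> Q"
      using i by blast
    then show ?thesis
      using sum_bipartite_resistance[of Q P i j] assms j False
        neighbours_complete_bipartite(2)[of P Q i] bipartite_resistance_swap[of P Q]
      by (simp add: Int_commute Un_commute)
  qed
  then show ?thesis
    by (auto simp: resistance_solution_def complete_bipartite_def bipartite_resistance_def)
qed

section \<open>Coalescences\<close>

text \<open>The merged vertex separates the two graphs, so resistances across it add as in series.
  The equations also cover \<open>Inr v\<close>, which is not a vertex of the coalescence but serves
  as a second name of \<open>Inl u\<close>.\<close>

fun glue ::
  "('a \<Rightarrow> 'a \<Rightarrow> real) \<Rightarrow> 'a \<Rightarrow> ('b \<Rightarrow> 'b \<Rightarrow> real) \<Rightarrow> 'b \<Rightarrow> 'a + 'b \<Rightarrow> 'a + 'b \<Rightarrow> real" where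
  "glue R u S v (Inl x) (Inl x') = R x x'"
| "glue R u S v (Inl x) (Inr y) = R x u + S v y"
| "glue R u S v (Inr y) (Inl x) = S y v + R u x"
| "glue R u S v (Inr y) (Inr y') = S y y'"

lemma neighbours_coalescence:
  fixes G :: "'a pair_pre_digraph" and H :: "'b pair_pre_digraph"
  shows "x \<noteq> u \<Longrightarrow> neighbours (coalescence G u H v) (Inl x) = Inl ` neighbours G x"
    and "neighbours (coalescence G u H v) (Inl u) =
      Inl ` neighbours G u \<union> (\<lambda>k. identify u v (Inr k)) ` neighbours H v"
    and "y \<noteq> v \<Longrightarrow> neighbours (coalescence G u H v) (Inr y) =
      (\<lambda>k. identify u v (Inr k)) ` neighbours H y"
proof -
  have arcs: "(s, t) \<in> parcs (coalescence G u H v) \<longleftrightarrow>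
      (\<exists>x y. (x, y) \<in> parcs G \<and> s = Inl x \<and> t = Inl y) \<or>
      (\<exists>x y. (x, y) \<in> parcs H \<and> s = identify u v (Inr x) \<and> t = identify u v (Inr y))" for s t
  proof -
    have "identify u v (Inl x) = Inl x" for x
      by (simp add: identify_def)
    then have "parcs (coalescence G u H v) = (\<lambda>(x, y). (Inl x, Inl y)) ` parcs G \<union>
        (\<lambda>(x, y). (identify u v (Inr x), identify u v (Inr y))) ` parcs H"
      by (simp add: coalescence_def image_Un image_image case_prod_unfold map_prod_def)
    then show ?thesis
      by auto
  qed
  have merged: "Inl x = identify u v (Inr k) \<longleftrightarrow> x = u \<and> k = v"
    "Inr y = identify u v (Inr k) \<longleftrightarrow> k = y \<and> y \<noteq> v" for x y k
    by (auto simp: identify_def)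
  show "x \<noteq> u \<Longrightarrow> neighbours (coalescence G u H v) (Inl x) = Inl ` neighbours G x"
    by (auto simp: neighbours_def arcs merged)
  show "neighbours (coalescence G u H v) (Inl u) =
      Inl ` neighbours G u \<union> (\<lambda>k. identify u v (Inr k)) ` neighbours H v"
    by (auto simp: neighbours_def arcs merged)
  show "y \<noteq> v \<Longrightarrow> neighbours (coalescence G u H v) (Inr y) =
      (\<lambda>k. identify u v (Inr k)) ` neighbours H y"
    by (auto simp: neighbours_def arcs merged)
qed

text \<open>For a target \<open>t\<close> in the copy of \<open>H\<close>, the glued function on the
  copy of \<open>G\<close> is \<open>R x u\<close> plus a constant, and the constant cancels in
  differences: seen from \<open>G\<close>, such a target acts like \<open>u\<close>, and likewise
  with the roles exchanged. At the merged vertex the two neighbour sums add up. Since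
  \<open>w\<close> is \<open>2\<close> minus the sum of resistances to the neighbours, its new value
  there is \<open>wG u + wH v - 2\<close>.\<close>

lemma resistance_solution_coalescence:
  fixes G :: "'a pair_pre_digraph" and H :: "'b pair_pre_digraph"
  assumes G: "pair_graph G" and H: "pair_graph H"
    and u: "u \<in> pverts G" and v: "v \<in> pverts H"
    and R: "resistance_solution G R wG" and S: "resistance_solution H S wH"
  shows "resistance_solution (coalescence G u H v) (glue R u S v)
    (case_sum (\<lambda>x. if x = u then wG u + wH v - 2 else wG x) wH)"
proof -
  interpret H: pair_graph H by fact
  let ?C = "coalescence G u H v" and ?D = "glue R u S v" and ?f = "\<lambda>k. identify u v (Inr k)"
  let ?w = "case_sum (\<lambda>x. if x = u then wG u + wH v - 2 else wG x) wH"
  have verts: "pverts ?C = Inl ` pverts G \<union> Inr ` (pverts H - {v})"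
    using u v by (auto simp: coalescence_def identify_def image_iff)
  have R0: "R i i = 0" if "i \<in> pverts G" for i
    using R that by (simp add: resistance_solution_def)
  have Rsym: "R i j = R j i" if "i \<in> pverts G" "j \<in> pverts G" for i j
    using R that by (simp add: resistance_solution_def)
  have Rsum: "(\<Sum>k\<in>neighbours G i. R k j - R i j) = (if i = j then 2 else 0) - wG i"
    if "i \<in> pverts G" "j \<in> pverts G" for i j
    using R that by (simp add: resistance_solution_def)
  have S0: "S i i = 0" if "i \<in> pverts H" for i
    using S that by (simp add: resistance_solution_def)
  have Ssym: "S i j = S j i" if "i \<in> pverts H" "j \<in> pverts H" for i j
    using S that by (simp add: resistance_solution_def)
  have Ssum: "(\<Sum>k\<in>neighbours H i. S k j - S i j) = (if i = j then 2 else 0) - wH i"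
    if "i \<in> pverts H" "j \<in> pverts H" for i j
    using S that by (simp add: resistance_solution_def)
  \<comment> \<open>Only \<open>k = v\<close> is affected by the identification; there the two sides
    agree because \<open>R u u = 0\<close> and \<open>S v v = 0\<close>.\<close>
  have D_merge: "?D (?f k) t = ?D (Inr k) t" if "t \<in> pverts ?C" for k t
    using that u v by (cases t) (auto simp: identify_def verts R0 S0)
  have inj: "inj_on ?f A" for A
    by (auto simp: inj_on_def identify_def split: if_splits)
  \<comment> \<open>The second disjunct records that a target in the copy of \<open>H\<close> acts
    like \<open>u\<close>.\<close>
  have sum_G: "(\<Sum>k\<in>neighbours G x. ?D (Inl k) t - ?D (Inl x) t) =
      (if t = Inl x \<or> x = u \<and> t \<in> range Inr then 2 else 0) - wG x"
    if "x \<in> pverts G" "t \<in> pverts ?C" for x t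
    using that u Rsum[of x] by (cases t) (auto simp: verts)
  have sum_H: "(\<Sum>k\<in>neighbours H y. ?D (Inr k) t - ?D (Inr y) t) =
      (if t = Inr y \<or> y = v \<and> t \<in> range Inl then 2 else 0) - wH y"
    if "y \<in> pverts H" "t \<in> pverts ?C" for y t
    using that v Ssum[of y] by (cases t) (auto simp: verts)
  have "(\<Sum>k\<in>neighbours ?C s. ?D k t - ?D s t) = (if s = t then 2 else 0) - ?w s"
    if s: "s \<in> pverts ?C" and t: "t \<in> pverts ?C" for s t
  proof (cases s)
    case (Inr y)
    then have y: "y \<in> pverts H" "y \<noteq> v"
      using s by (auto simp: verts)
    show ?thesis
      using sum_H[OF y(1) t] y
      by (auto simp: Inr neighbours_coalescence sum.reindex[OF inj] D_merge[OF t])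
  next
    case (Inl x)
    then have x: "x \<in> pverts G"
      using s by (auto simp: verts)
    show ?thesis
    proof (cases "x = u")
      case False
      then show ?thesis
        using sum_G[OF x t] by (auto simp: Inl neighbours_coalescence sum.reindex)
    next
      case True
      have D_u: "?D (Inl u) t = ?D (Inr v) t"
        using D_merge[OF t, of v] by (simp add: identify_def)
      \<comment> \<open>A common element would be the image of \<open>v\<close>, but
        \<open>v\<close> is not its own neighbour.\<close>
      have "Inl ` neighbours G u \<inter> ?f ` neighbours H v = {}"
        using H.no_loops' by (auto simp: identify_def neighbours_def split: if_splits)
      then have "(\<Sum>k\<in>neighbours ?C s. ?D k t - ?D s t) =
          (\<Sum>k\<in>neighbours G u. ?D (Inl k) t - ?D (Inl u) t) +
          (\<Sum>k\<in>neighbours H v. ?D (Inr k) t - ?D (Inr v) t)"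
        using G H
        by (simp add: Inl True neighbours_coalescence sum.union_disjoint finite_neighbours
            sum.reindex[OF inj] sum.reindex D_merge[OF t] D_u)
      \<comment> \<open>Every \<open>t\<close> now receives a \<open>2\<close> from exactly one of
        the two sums, except \<open>Inl u\<close>, which receives it from both; the
        \<open>- 2\<close> in the new \<open>w\<close> absorbs one of them.\<close>
      moreover have "t \<noteq> Inr v"
        using t by (auto simp: verts)
      ultimately show ?thesis
        using sum_G[OF u t] sum_H[OF v t] by (cases t) (auto simp: Inl True)
    qed
  qed
  moreover have "?D s s = 0" if "s \<in> pverts ?C" for s
    using that by (auto simp: verts R0 S0)
  moreover have "?D s t = ?D t s" if "s \<in> pverts ?C" "t \<in> pverts ?C" for s t
    using that u v by (auto simp: verts Rsym Ssym)
  ultimately show ?thesis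
    by (simp add: resistance_solution_def)
qed

section \<open>Attaching a star to a complete bipartite graph\<close>

theorem theorem3p4:
  fixes p q n :: nat
    and P Q :: "'a set" and a :: 'a
    and N :: "'b set" and c :: 'b
    and G :: "('a + 'b) pair_pre_digraph"
  assumes "p \<ge> 1" and "q \<ge> 1" and "n \<ge> 1"
    and "finite P" and "finite Q" and "finite N"
    and "card P = p" and "card Q = q" and "card N = n"
    and "P \<inter> Q = {}" and "a \<in> P" and "c \<notin> N"
    and G: "G = coalescence (complete_bipartite P Q) a (star c N) c"
  shows
    "(\<forall>x\<in>P - {a}. resistance G (Inl a) (Inl x) = 2 / real q) \<and>
     (\<forall>y\<in>Q. resistance G (Inl a) (Inl y) = (real p + real q - 1) / (real p * real q)) \<and>
     (\<forall>z\<in>N. resistance G (Inl a) (Inr z) = 1) \<and>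
     (\<forall>x\<in>P - {a}. \<forall>x'\<in>P - {a}. x \<noteq> x' \<longrightarrow> resistance G (Inl x) (Inl x') = 2 / real q) \<and>
     (\<forall>x\<in>P - {a}. \<forall>y\<in>Q.
        resistance G (Inl x) (Inl y) = (real p + real q - 1) / (real p * real q)) \<and>
     (\<forall>x\<in>P - {a}. \<forall>z\<in>N. resistance G (Inl x) (Inr z) = (real q + 2) / real q) \<and>
     (\<forall>y\<in>Q. \<forall>y'\<in>Q. y \<noteq> y' \<longrightarrow> resistance G (Inl y) (Inl y') = 2 / real p) \<and>
     (\<forall>y\<in>Q. \<forall>z\<in>N. resistance G (Inl y) (Inr z) =
        (real q * (real p + 1) + (real p - 1)) / (real p * real q)) \<and>
     (\<forall>z\<in>N. \<forall>z'\<in>N. z \<noteq> z' \<longrightarrow> resistance G (Inr z) (Inr z') = 2)"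
proof -
  have P: "P \<noteq> {}" and Q: "Q \<noteq> {}" and N: "N \<noteq> {}"
    using assms by auto
  have cN: "{c} \<inter> N = {}"
    using \<open>c \<notin> N\<close> by simp
  let ?R = "bipartite_resistance P Q" and ?S = "bipartite_resistance {c} N"
  note graphs =
    pair_graph_complete_bipartite[OF \<open>finite P\<close> \<open>finite Q\<close> \<open>P \<inter> Q = {}\<close>]
    pair_graph_complete_bipartite[OF _ \<open>finite N\<close> cN, folded star_def, simplified]
  have "a \<in> pverts (complete_bipartite P Q)" "c \<in> pverts (star c N)"
    using \<open>a \<in> P\<close> by (auto simp: star_def complete_bipartite_def)
  \<comment> \<open>The star is itself complete bipartite with parts \<open>{c}\<close> and
    \<open>N\<close>, so one closed form serves both pieces.\<close>
  from resistance_solution_coalescence[OF graphs this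
      resistance_solution_complete_bipartite[OF \<open>finite P\<close> \<open>finite Q\<close> P Q \<open>P \<inter> Q = {}\<close>]
      resistance_solution_complete_bipartite[OF _ \<open>finite N\<close> _ N cN, folded star_def, simplified]]
  have res: "resistance G s t = glue ?R a ?S c s t" if "s \<in> pverts G" "t \<in> pverts G" for s t
    using resistance_eqI[OF pair_graph_coalescence[OF graphs]] that unfolding G by blast
  have PG: "Inl x \<in> pverts G" if "x \<in> P \<union> Q" for x
    using that by (force simp: G coalescence_def complete_bipartite_def identify_def)
  \<comment> \<open>As \<open>c \<notin> N\<close>, no pendant vertex is merged into
    \<open>Inl a\<close>.\<close>
  have NG: "Inr z \<in> pverts G" if "z \<in> N" for z
    using that \<open>c \<notin> N\<close> unfolding G coalescence_def star_def complete_bipartite_def identify_def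
    by force
  have ac: "a \<notin> Q" "a \<in> P"
    using assms by auto
  have R_PP: "?R x x' = 2 / real q" if "x \<in> P" "x' \<in> P" "x \<noteq> x'" for x x'
    using that assms by (simp add: bipartite_resistance_def)
  have R_aP: "?R a x = 2 / real q" if "x \<in> P" "x \<noteq> a" for x
    using R_PP \<open>a \<in> P\<close> that by blast
  have R_PQ: "?R x y = (real p + real q - 1) / (real p * real q)"
    and R_QP: "?R y x = (real p + real q - 1) / (real p * real q)" if "x \<in> P" "y \<in> Q" for x y
    using that assms by (auto simp: bipartite_resistance_def)
  have R_QQ: "?R y y' = 2 / real p" if "y \<in> Q" "y' \<in> Q" "y \<noteq> y'" for y y'
    using that assms by (auto simp: bipartite_resistance_def)
  have R_aa: "?R a a = 0"
    by (simp add: bipartite_resistance_def)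
  \<comment> \<open>With part sizes \<open>1\<close> and \<open>n\<close> the value for an edge is
    \<open>(1 + n - 1) / n\<close>.\<close>
  have S_cN: "?S c z = 1" if "z \<in> N" for z
    using that assms by (auto simp: bipartite_resistance_def)
  have S_NN: "?S z z' = 2" if "z \<in> N" "z' \<in> N" "z \<noteq> z'" for z z'
    using that assms by (auto simp: bipartite_resistance_def)
  show ?thesis
    using ac assms(1,2)
    \<comment> \<open>The distances from \<open>P - {a}\<close> and \<open>Q\<close> to
      \<open>N\<close> arise as \<open>2 / q + 1\<close> and
      \<open>(p + q - 1) / (p * q) + 1\<close>; \<open>field_simps\<close> brings them over the
      stated denominators.\<close>
    by (auto simp: res PG NG R_PP R_aP R_PQ R_QP R_QQ R_aa S_cN S_NN) (auto simp: field_simps)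
qed

end
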